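(* Let $T>0$ and let $f:[0,T]\to\mathbb R$ be integrable. Let $(A,x,e)$ be the solution on $[0,T]$ of the linear system $$\dot A=-A+f,\qquad \dot x=A,\qquad \dot e=8x-13e-A,\qquad (A,x,e)(0)=(0,0,0).$$ Define $$M_0=\int_0^T f(t)\,dt,\qquad M_1=\int_0^T e^{-(T-t)}f(t)\,dt,\qquad M_{13}=\int_0^T e^{-13(T-t)}f(t)\,dt .$$ Then $$A(T)=M_1,\qquad x(T)=M_0-M_1,\qquad e(T)=\frac{32M_0-39M_1+7M_{13}}{52}.$$ Consequently, $(A,x,e)(T)=(0,0,0)$ if and only if $M_0=M_1=M_{13}=0$.
   Context: In the integrals $M_1$ and $M_{13}$, $e^{-(T-t)}$ and $e^{-13(T-t)}$ denote the exponential function, while $e(t)$ is the third unknown of the system. For integrable $f$ the solution is the unique absolutely continuous one (equations holding almost everywhere). *)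

theory Defs
  imports "HOL-Analysis.Analysis"
begin

(* The library's absolutely_continuous relates two measures; this is the
   epsilon-delta notion for a function on a compact interval. *)
definition abs_cont_on_interval :: "real \<Rightarrow> real \<Rightarrow> (real \<Rightarrow> real) \<Rightarrow> bool" where
  "abs_cont_on_interval a b F \<longleftrightarrow>
     (\<forall>\<epsilon>>0. \<exists>\<delta>>0. \<forall>(n::nat) (u::nat \<Rightarrow> real) (v::nat \<Rightarrow> real).
        (\<forall>i<n. a \<le> u i \<and> u i < v i \<and> v i \<le> b) \<longrightarrow>
        disjoint_family_on (\<lambda>i. {u i<..<v i}) {..<n} \<longrightarrow>
        (\<Sum>i<n. v i - u i) < \<delta> \<longrightarrow>
        (\<Sum>i<n. \<bar>F (v i) - F (u i)\<bar>) < \<epsilon>)"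

(* A Caratheodory solution on [0,T]; the values of f, A, x, e outside [0,T]
   are irrelevant. *)
definition system_solution ::
  "real \<Rightarrow> (real \<Rightarrow> real) \<Rightarrow> (real \<Rightarrow> real) \<Rightarrow> (real \<Rightarrow> real) \<Rightarrow> (real \<Rightarrow> real) \<Rightarrow> bool" where
  "system_solution T f A x e \<longleftrightarrow>
     abs_cont_on_interval 0 T A \<and> abs_cont_on_interval 0 T x \<and> abs_cont_on_interval 0 T e \<and>
     (AE t\<in>{0..T} in lebesgue.
        (A has_real_derivative (- A t + f t)) (at t within {0..T}) \<and>
        (x has_real_derivative A t) (at t within {0..T}) \<and>
        (e has_real_derivative (8 * x t - 13 * e t - A t)) (at t within {0..T})) \<and>
     (A 0, x 0, e 0) = (0, 0, 0)"

end

theory Submission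
  imports Defs
begin

text \<open>
  The system matrix is diagonalizable, and its left eigenvectors decouple the system: the
  combinations \<open>A + x\<close>, \<open>A\<close> and \<open>e - 8/13 x + 7/52 A\<close> each solve a scalar equation
  \<open>y' = - k y + c f\<close> with \<open>k = 0, 1, 13\<close> and \<open>c = 1, 1, 7/52\<close>.  Variation of constants
  (\<open>linear_ode_solution\<close>) expresses each of them at time \<open>T\<close> as \<open>c\<close> times one of the moments \<open>M0\<close>, \<open>M1\<close>, \<open>M13\<close>, and
  solving a triangular linear system recovers \<open>A T\<close>, \<open>x T\<close> and \<open>e T\<close>.  As that
  linear system is invertible, the state vanishes exactly when all moments do.

  Since the equations hold only almost everywhere, variation of constants rests on the fundamental
  theorem of calculus for absolutely continuous functions (\<open>abs_cont_has_integral\<close>).  It is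
  proved with gauges rather than through Lebesgue's differentiation theorem: in a fine tagged
  division, intervals tagged at points of differentiability are handled by the definition of the
  derivative, while those tagged in the exceptional null set lie in an open set of small measure, so
  absolute continuity makes the increments over them negligible in total.
\<close>

section \<open>Absolutely continuous functions\<close>

lemma abs_cont_on_intervalE:
  assumes "abs_cont_on_interval a b F" and "\<epsilon> > 0"
  obtains \<delta> where "\<delta> > 0"
    and "\<And>(n::nat) u v. \<lbrakk>\<And>i. i < n \<Longrightarrow> a \<le> u i \<and> u i < v i \<and> v i \<le> b;
           disjoint_family_on (\<lambda>i. {u i<..<v i}) {..<n}; (\<Sum>i<n. v i - u i) < \<delta>\<rbrakk>
         \<Longrightarrow> (\<Sum>i<n. \<bar>F (v i) - F (u i)\<bar>) < \<epsilon>"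
  using assms unfolding abs_cont_on_interval_def by meson

lemma abs_cont_lipschitz:
  assumes lip: "\<And>s t. \<lbrakk>a \<le> s; s < t; t \<le> b\<rbrakk> \<Longrightarrow> \<bar>F t - F s\<bar> \<le> L * (t - s)"
  shows "abs_cont_on_interval a b F"
  unfolding abs_cont_on_interval_def
proof (intro allI impI)
  fix \<epsilon> :: real
  assume "\<epsilon> > 0"
  define \<delta> where "\<delta> = \<epsilon> / (\<bar>L\<bar> + 1)"
  have "(\<Sum>i<n. \<bar>F (v i) - F (u i)\<bar>) < \<epsilon>"
    if uv: "\<forall>i<n. a \<le> u i \<and> u i < v i \<and> v i \<le> b" and small: "(\<Sum>i<n. v i - u i) < \<delta>"
    for n :: nat and u v
  proof -
    have "(\<Sum>i<n. \<bar>F (v i) - F (u i)\<bar>) \<le> (\<Sum>i<n. (\<bar>L\<bar> + 1) * (v i - u i))"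
    proof (rule sum_mono)
      fix i assume "i \<in> {..<n}"
      then have i: "a \<le> u i" "u i < v i" "v i \<le> b" using uv by auto
      have "\<bar>F (v i) - F (u i)\<bar> \<le> L * (v i - u i)" using lip i by blast
      also have "\<dots> \<le> (\<bar>L\<bar> + 1) * (v i - u i)" using i by (intro mult_right_mono) auto
      finally show "\<bar>F (v i) - F (u i)\<bar> \<le> (\<bar>L\<bar> + 1) * (v i - u i)" .
    qed
    also have "\<dots> = (\<bar>L\<bar> + 1) * (\<Sum>i<n. v i - u i)" by (simp add: sum_distrib_left)
    also have "\<dots> < (\<bar>L\<bar> + 1) * \<delta>" using small by (intro mult_strict_left_mono) auto
    also have "\<dots> = \<epsilon>" by (simp add: \<delta>_def)
    finally show ?thesis .
  qed
  moreover have "\<delta> > 0" using \<open>\<epsilon> > 0\<close> by (simp add: \<delta>_def)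
  ultimately show "\<exists>\<delta>>0. \<forall>(n::nat) u v. (\<forall>i<n. a \<le> u i \<and> u i < v i \<and> v i \<le> b) \<longrightarrow>
      disjoint_family_on (\<lambda>i. {u i<..<v i}) {..<n} \<longrightarrow> (\<Sum>i<n. v i - u i) < \<delta> \<longrightarrow>
      (\<Sum>i<n. \<bar>F (v i) - F (u i)\<bar>) < \<epsilon>"
    by blast
qed

text \<open>
  Sums and products of absolutely continuous functions are instances of one closure principle: it
  suffices that each increment of \<open>H\<close> is dominated by a fixed combination of increments of two
  absolutely continuous functions.
\<close>

lemma abs_cont_dominated:
  assumes F: "abs_cont_on_interval a b F" and G: "abs_cont_on_interval a b G"
    and dom: "\<And>s t. \<lbrakk>a \<le> s; s < t; t \<le> b\<rbrakk> \<Longrightarrow> \<bar>H t - H s\<bar> \<le> C * (\<bar>F t - F s\<bar> + \<bar>G t - G s\<bar>)"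
  shows "abs_cont_on_interval a b H"
  unfolding abs_cont_on_interval_def
proof (intro allI impI)
  fix \<epsilon> :: real
  assume "\<epsilon> > 0"
  define \<eta> where "\<eta> = \<epsilon> / (2 * (\<bar>C\<bar> + 1))"
  have "\<eta> > 0" using \<open>\<epsilon> > 0\<close> by (simp add: \<eta>_def)
  obtain \<delta>1 where \<delta>1: "\<delta>1 > 0"
    "\<And>(n::nat) u v. \<lbrakk>\<And>i. i < n \<Longrightarrow> a \<le> u i \<and> u i < v i \<and> v i \<le> b;
           disjoint_family_on (\<lambda>i. {u i<..<v i}) {..<n}; (\<Sum>i<n. v i - u i) < \<delta>1\<rbrakk>
         \<Longrightarrow> (\<Sum>i<n. \<bar>F (v i) - F (u i)\<bar>) < \<eta>"
    using abs_cont_on_intervalE[OF F \<open>\<eta> > 0\<close>] by blast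
  obtain \<delta>2 where \<delta>2: "\<delta>2 > 0"
    "\<And>(n::nat) u v. \<lbrakk>\<And>i. i < n \<Longrightarrow> a \<le> u i \<and> u i < v i \<and> v i \<le> b;
           disjoint_family_on (\<lambda>i. {u i<..<v i}) {..<n}; (\<Sum>i<n. v i - u i) < \<delta>2\<rbrakk>
         \<Longrightarrow> (\<Sum>i<n. \<bar>G (v i) - G (u i)\<bar>) < \<eta>"
    using abs_cont_on_intervalE[OF G \<open>\<eta> > 0\<close>] by blast
  have "(\<Sum>i<n. \<bar>H (v i) - H (u i)\<bar>) < \<epsilon>"
    if uv: "\<forall>i<n. a \<le> u i \<and> u i < v i \<and> v i \<le> b"
      and disj: "disjoint_family_on (\<lambda>i. {u i<..<v i}) {..<n}"
      and small: "(\<Sum>i<n. v i - u i) < min \<delta>1 \<delta>2"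
    for n :: nat and u v
  proof -
    have sF: "(\<Sum>i<n. \<bar>F (v i) - F (u i)\<bar>) < \<eta>" using uv disj small by (intro \<delta>1(2)) auto
    have sG: "(\<Sum>i<n. \<bar>G (v i) - G (u i)\<bar>) < \<eta>" using uv disj small by (intro \<delta>2(2)) auto
    have "(\<Sum>i<n. \<bar>H (v i) - H (u i)\<bar>)
        \<le> (\<Sum>i<n. (\<bar>C\<bar> + 1) * (\<bar>F (v i) - F (u i)\<bar> + \<bar>G (v i) - G (u i)\<bar>))"
    proof (rule sum_mono)
      fix i assume "i \<in> {..<n}"
      then have "\<bar>H (v i) - H (u i)\<bar> \<le> C * (\<bar>F (v i) - F (u i)\<bar> + \<bar>G (v i) - G (u i)\<bar>)"
        using uv dom by blast
      also have "\<dots> \<le> (\<bar>C\<bar> + 1) * (\<bar>F (v i) - F (u i)\<bar> + \<bar>G (v i) - G (u i)\<bar>)"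
        by (intro mult_right_mono) auto
      finally show "\<bar>H (v i) - H (u i)\<bar> \<le> (\<bar>C\<bar> + 1) * (\<bar>F (v i) - F (u i)\<bar> + \<bar>G (v i) - G (u i)\<bar>)" .
    qed
    also have "\<dots> = (\<bar>C\<bar> + 1) * ((\<Sum>i<n. \<bar>F (v i) - F (u i)\<bar>) + (\<Sum>i<n. \<bar>G (v i) - G (u i)\<bar>))"
      by (simp add: sum_distrib_left[symmetric] sum.distrib)
    also have "\<dots> < (\<bar>C\<bar> + 1) * (\<eta> + \<eta>)"
      using sF sG by (intro mult_strict_left_mono add_strict_mono) auto
    also have "\<dots> = 2 * (\<bar>C\<bar> + 1) * \<eta>" by simp
    also have "\<dots> = \<epsilon>" unfolding \<eta>_def by simp
    finally show ?thesis .
  qed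
  moreover have "min \<delta>1 \<delta>2 > 0" using \<delta>1(1) \<delta>2(1) by simp
  ultimately show "\<exists>\<delta>>0. \<forall>(n::nat) u v. (\<forall>i<n. a \<le> u i \<and> u i < v i \<and> v i \<le> b) \<longrightarrow>
      disjoint_family_on (\<lambda>i. {u i<..<v i}) {..<n} \<longrightarrow> (\<Sum>i<n. v i - u i) < \<delta> \<longrightarrow>
      (\<Sum>i<n. \<bar>H (v i) - H (u i)\<bar>) < \<epsilon>"
    by blast
qed

lemma abs_cont_lincomb:
  assumes "abs_cont_on_interval a b F" "abs_cont_on_interval a b G"
  shows "abs_cont_on_interval a b (\<lambda>t. c * F t + d * G t)"
proof (rule abs_cont_dominated[OF assms])
  fix s t :: real
  have "\<bar>(c * F t + d * G t) - (c * F s + d * G s)\<bar> = \<bar>c * (F t - F s) + d * (G t - G s)\<bar>"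
    by (simp add: algebra_simps)
  also have "\<dots> \<le> \<bar>c\<bar> * \<bar>F t - F s\<bar> + \<bar>d\<bar> * \<bar>G t - G s\<bar>"
    by (metis abs_mult abs_triangle_ineq)
  also have "\<dots> \<le> (\<bar>c\<bar> + \<bar>d\<bar>) * \<bar>F t - F s\<bar> + (\<bar>c\<bar> + \<bar>d\<bar>) * \<bar>G t - G s\<bar>"
    by (intro add_mono mult_right_mono) auto
  finally show "\<bar>(c * F t + d * G t) - (c * F s + d * G s)\<bar>
      \<le> (\<bar>c\<bar> + \<bar>d\<bar>) * (\<bar>F t - F s\<bar> + \<bar>G t - G s\<bar>)"
    by (simp add: distrib_left)
qed

lemma abs_cont_continuous_on:
  assumes "abs_cont_on_interval a b F"
  shows "continuous_on {a..b} F"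
  unfolding continuous_on_iff
proof (intro ballI allI impI)
  fix t \<epsilon> :: real
  assume t: "t \<in> {a..b}" and "\<epsilon> > 0"
  obtain \<delta> where \<delta>: "\<delta> > 0"
    "\<And>(n::nat) u v. \<lbrakk>\<And>i. i < n \<Longrightarrow> a \<le> u i \<and> u i < v i \<and> v i \<le> b;
           disjoint_family_on (\<lambda>i. {u i<..<v i}) {..<n}; (\<Sum>i<n. v i - u i) < \<delta>\<rbrakk>
         \<Longrightarrow> (\<Sum>i<n. \<bar>F (v i) - F (u i)\<bar>) < \<epsilon>"
    using abs_cont_on_intervalE[OF assms \<open>\<epsilon> > 0\<close>] by blast
  have one: "\<bar>F r - F s\<bar> < \<epsilon>" if "a \<le> s" "s < r" "r \<le> b" "r - s < \<delta>" for s r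
    using \<delta>(2)[of 1 "\<lambda>_. s" "\<lambda>_. r"] that by (simp add: disjoint_family_on_def)
  have "dist (F s) (F t) < \<epsilon>" if "s \<in> {a..b}" "dist s t < \<delta>" for s
    using one[of s t] one[of t s] that t \<open>\<epsilon> > 0\<close>
    by (cases s t rule: linorder_cases) (auto simp: dist_real_def abs_minus_commute)
  then show "\<exists>d>0. \<forall>s\<in>{a..b}. dist s t < d \<longrightarrow> dist (F s) (F t) < \<epsilon>"
    using \<delta>(1) by blast
qed

lemma abs_cont_bounded:
  assumes "abs_cont_on_interval a b F"
  obtains B where "\<And>t. t \<in> {a..b} \<Longrightarrow> \<bar>F t\<bar> \<le> B"
proof -
  have "bounded (F ` {a..b})"
    using abs_cont_continuous_on[OF assms] compact_continuous_image compact_imp_bounded by blast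
  then show ?thesis using that unfolding bounded_iff by force
qed

lemma abs_cont_mult:
  assumes F: "abs_cont_on_interval a b F" and G: "abs_cont_on_interval a b G"
  shows "abs_cont_on_interval a b (\<lambda>t. F t * G t)"
proof -
  obtain B where B: "\<And>t. t \<in> {a..b} \<Longrightarrow> \<bar>F t\<bar> \<le> B" using abs_cont_bounded[OF F] by blast
  obtain C where C: "\<And>t. t \<in> {a..b} \<Longrightarrow> \<bar>G t\<bar> \<le> C" using abs_cont_bounded[OF G] by blast
  show ?thesis
  proof (rule abs_cont_dominated[OF F G])
    fix s t :: real
    assume st: "a \<le> s" "s < t" "t \<le> b"
    have Ft: "\<bar>F t\<bar> \<le> B" and Gs: "\<bar>G s\<bar> \<le> C" using st B C by auto
    have "\<bar>F t * G t - F s * G s\<bar> = \<bar>F t * (G t - G s) + G s * (F t - F s)\<bar>"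
      by (simp add: algebra_simps)
    also have "\<dots> \<le> \<bar>F t\<bar> * \<bar>G t - G s\<bar> + \<bar>G s\<bar> * \<bar>F t - F s\<bar>"
      by (metis abs_mult abs_triangle_ineq)
    also have "\<dots> \<le> (B + C) * \<bar>G t - G s\<bar> + (B + C) * \<bar>F t - F s\<bar>"
      using Ft Gs by (intro add_mono mult_right_mono) auto
    finally show "\<bar>F t * G t - F s * G s\<bar> \<le> (B + C) * (\<bar>F t - F s\<bar> + \<bar>G t - G s\<bar>)"
      by (simp add: distrib_left add.commute)
  qed
qed

lemma abs_cont_exp_affine:
  fixes k c a b :: real
  shows "abs_cont_on_interval a b (\<lambda>t. exp (k * t + c))"
proof -
  have "compact ((\<lambda>t. k * exp (k * t + c)) ` {a..b})"
    by (intro compact_continuous_image continuous_intros) auto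
  then have "bounded ((\<lambda>t. k * exp (k * t + c)) ` {a..b})" by (rule compact_imp_bounded)
  then obtain L where L: "\<And>t. t \<in> {a..b} \<Longrightarrow> \<bar>k * exp (k * t + c)\<bar> \<le> L"
    unfolding bounded_iff by force
  show ?thesis
  proof (rule abs_cont_lipschitz)
    fix s t :: real
    assume st: "a \<le> s" "s < t" "t \<le> b"
    have der: "((\<lambda>t. exp (k * t + c)) has_real_derivative k * exp (k * z + c)) (at z)" for z
      by (auto intro!: derivative_eq_intros)
    obtain z where z: "s < z" "z < t" "exp (k * t + c) - exp (k * s + c) = (t - s) * (k * exp (k * z + c))"
      using MVT2[OF st(2) der] by blast
    have "\<bar>exp (k * t + c) - exp (k * s + c)\<bar> = (t - s) * \<bar>k * exp (k * z + c)\<bar>"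
      unfolding z(3) abs_mult[of "t - s"] using st by simp
    also have "\<dots> \<le> (t - s) * L" using st z L by (intro mult_left_mono) auto
    finally show "\<bar>exp (k * t + c) - exp (k * s + c)\<bar> \<le> L * (t - s)" by (simp add: mult.commute)
  qed
qed

section \<open>The fundamental theorem of calculus\<close>

text \<open>
  Restates absolute continuity for the families that occur in gauge integration.  Degenerate
  intervals have no increment and are dropped; the others have pairwise disjoint interiors.
\<close>

lemma abs_cont_tagged_partial_division:
  assumes "abs_cont_on_interval a b F" and "\<epsilon> > 0"
  obtains \<delta> where "\<delta> > 0"
    and "\<And>p. \<lbrakk>p tagged_partial_division_of {a..b}; (\<Sum>(x,K)\<in>p. measure lborel K) < \<delta>\<rbrakk>
         \<Longrightarrow> (\<Sum>(x,K)\<in>p. \<bar>F (Sup K) - F (Inf K)\<bar>) < \<epsilon>"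
proof -
  obtain \<delta> where \<delta>: "\<delta> > 0"
    "\<And>(n::nat) u v. \<lbrakk>\<And>i. i < n \<Longrightarrow> a \<le> u i \<and> u i < v i \<and> v i \<le> b;
           disjoint_family_on (\<lambda>i. {u i<..<v i}) {..<n}; (\<Sum>i<n. v i - u i) < \<delta>\<rbrakk>
         \<Longrightarrow> (\<Sum>i<n. \<bar>F (v i) - F (u i)\<bar>) < \<epsilon>"
    using abs_cont_on_intervalE[OF assms] by blast
  show thesis
  proof (rule that[OF \<delta>(1)])
    fix p
    assume p: "p tagged_partial_division_of {a..b}" and small: "(\<Sum>(x,K)\<in>p. measure lborel K) < \<delta>"
    note pD = tagged_partial_division_ofD[OF p]
    have shape: "K = {Inf K..Sup K} \<and> a \<le> Inf K \<and> Inf K \<le> Sup K \<and> Sup K \<le> b" if xK: "(x, K) \<in> p" for x K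
    proof -
      obtain u v where K: "K = {u..v}" using pD(4)[OF xK] by auto
      have "u \<le> v" using pD(2)[OF xK] K by auto
      then show ?thesis using pD(3)[OF xK] K by auto
    qed
    define q where "q = {z \<in> p. Inf (snd z) < Sup (snd z)}"
    have "finite q" using pD(1) by (simp add: q_def)
    then obtain h where h: "bij_betw h {..<card q} q"
      using ex_bij_betw_nat_finite[of q] by (auto simp: atLeast0LessThan)
    have hq: "h i \<in> q" if "i < card q" for i using h that by (auto simp: bij_betw_def)
    define u where "u = (\<lambda>i. Inf (snd (h i)))"
    define v where "v = (\<lambda>i. Sup (snd (h i)))"
    have hp: "(fst (h i), snd (h i)) \<in> p" and lt: "u i < v i" if "i < card q" for i
      using hq[OF that] by (auto simp: q_def u_def v_def)
    have reindex: "(\<Sum>i<card q. g (snd (h i))) = (\<Sum>(x,K)\<in>p. g K)"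
      if g: "\<And>K. Inf K = Sup K \<Longrightarrow> K \<noteq> {} \<Longrightarrow> K = {Inf K..Sup K} \<Longrightarrow> g K = 0" for g :: "real set \<Rightarrow> real"
    proof -
      have "(\<Sum>i<card q. g (snd (h i))) = (\<Sum>z\<in>q. g (snd z))"
        using sum.reindex_bij_betw[OF h, of "\<lambda>z. g (snd z)"] .
      also have "\<dots> = (\<Sum>z\<in>p. g (snd z))"
      proof (rule sum.mono_neutral_left)
        show "\<forall>z\<in>p - q. g (snd z) = 0"
        proof
          fix z assume z: "z \<in> p - q"
          then have zp: "(fst z, snd z) \<in> p" by simp
          have "snd z \<noteq> {}" using pD(2)[OF zp] by blast
          moreover have "Inf (snd z) = Sup (snd z)" using shape[OF zp] z by (auto simp: q_def)
          ultimately show "g (snd z) = 0" using g shape[OF zp] by blast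
        qed
      qed (auto simp: pD(1) q_def)
      finally show ?thesis by (simp add: case_prod_beta)
    qed
    have "(\<Sum>i<card q. \<bar>F (v i) - F (u i)\<bar>) < \<epsilon>"
    proof (rule \<delta>(2))
      show "a \<le> u i \<and> u i < v i \<and> v i \<le> b" if "i < card q" for i
        using shape[OF hp[OF that]] lt[OF that] by (auto simp: u_def v_def)
      show "disjoint_family_on (\<lambda>i. {u i<..<v i}) {..<card q}"
        unfolding disjoint_family_on_def
      proof (intro ballI impI)
        fix i j assume ij: "i \<in> {..<card q}" "j \<in> {..<card q}" "i \<noteq> j"
        have "h i \<noteq> h j" using h ij by (auto simp: bij_betw_def inj_on_def)
        then have "interior (snd (h i)) \<inter> interior (snd (h j)) = {}"
          using ij by (intro pD(5)[OF hp hp]) (auto simp: prod_eq_iff)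
        moreover have "interior (snd (h l)) = {u l<..<v l}" if "l < card q" for l
          unfolding u_def v_def using shape[OF hp[OF that]] interior_atLeastAtMost_real by metis
        ultimately show "{u i<..<v i} \<inter> {u j<..<v j} = {}" using ij by simp
      qed
      have "(\<Sum>i<card q. v i - u i) = (\<Sum>(x,K)\<in>p. Sup K - Inf K)"
        unfolding u_def v_def by (rule reindex) simp
      also have "\<dots> = (\<Sum>(x,K)\<in>p. measure lborel K)"
      proof (rule sum.cong[OF refl], clarify)
        fix x K assume "(x, K) \<in> p"
        then show "Sup K - Inf K = measure lborel K" using shape content_real by metis
      qed
      finally show "(\<Sum>i<card q. v i - u i) < \<delta>" using small by simp
    qed
    moreover have "(\<Sum>i<card q. \<bar>F (v i) - F (u i)\<bar>) = (\<Sum>(x,K)\<in>p. \<bar>F (Sup K) - F (Inf K)\<bar>)"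
      unfolding u_def v_def by (rule reindex) simp
    ultimately show "(\<Sum>(x,K)\<in>p. \<bar>F (Sup K) - F (Inf K)\<bar>) < \<epsilon>" by simp
  qed
qed

lemma negligible_outer_open:
  fixes N :: "real set"
  assumes "negligible N" and "\<delta> > 0"
  obtains U where "open U" "N \<subseteq> U" "U \<in> lmeasurable" "measure lebesgue U < \<delta>"
proof -
  have null: "N \<in> null_sets lebesgue" using assms(1) by (simp add: negligible_iff_null_sets)
  then have N: "N \<in> sets lebesgue" by auto
  obtain U where U: "open U" "N \<subseteq> U" "U - N \<in> lmeasurable" "emeasure lebesgue (U - N) < ennreal \<delta>"
    using sets_lebesgue_outer_open[OF N assms(2)] by blast
  have Usets: "U \<in> sets lebesgue" using U(1) by (simp add: borel_open)
  then have eq: "emeasure lebesgue U = emeasure lebesgue (U - N)"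
    using emeasure_Diff_null_set[OF null] by simp
  then have "U \<in> lmeasurable"
    using U(4) Usets by (intro fmeasurableI) (auto simp: less_top[symmetric] intro: order_less_trans)
  moreover have "measure lebesgue U < \<delta>"
    using U(4) unfolding eq[symmetric] emeasure_eq_measure2[OF \<open>U \<in> lmeasurable\<close>]
    by (subst (asm) ennreal_less_iff) auto
  ultimately show thesis using U that by blast
qed

lemma straddle_increment:
  fixes F :: "real \<Rightarrow> real"
  assumes K: "K = {u..v}" "x \<in> K"
    and close: "\<And>y. y \<in> K \<Longrightarrow> \<bar>F y - F x - D * (y - x)\<bar> \<le> \<eta> * \<bar>y - x\<bar>"
  shows "\<bar>measure lborel K * D - (F (Sup K) - F (Inf K))\<bar> \<le> \<eta> * measure lborel K"
proof -
  have x: "u \<le> x" "x \<le> v" using K by auto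
  then have "\<bar>F u - F x - D * (u - x)\<bar> \<le> \<eta> * (x - u)" "\<bar>F v - F x - D * (v - x)\<bar> \<le> \<eta> * (v - x)"
    using close[of u] close[of v] K by auto
  then have "\<bar>(v - u) * D - (F v - F u)\<bar> \<le> \<eta> * (v - u)"
    by (simp add: algebra_simps abs_le_iff)
  then show ?thesis using x K by simp
qed

text \<open>
  The integrand is first replaced by \<open>0\<close> on the exceptional set \<open>N\<close>, so that an interval tagged
  in \<open>N\<close> contributes only the increment of \<open>F\<close>.  The gauge is chosen from the derivative off \<open>N\<close>
  and confines intervals tagged in \<open>N\<close> to a small open neighbourhood of \<open>N\<close>.
\<close>

theorem abs_cont_has_integral:
  fixes F g :: "real \<Rightarrow> real"
  assumes "a \<le> b" and ac: "abs_cont_on_interval a b F" and N: "negligible N"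
    and der: "\<And>t. t \<in> {a..b} - N \<Longrightarrow> (F has_real_derivative g t) (at t within {a..b})"
  shows "(g has_integral (F b - F a)) {a..b}"
proof -
  define g0 where "g0 = (\<lambda>t. if t \<in> N then 0 else g t)"
  have "(g0 has_integral (F b - F a)) {a..b}"
    unfolding has_integral_real
  proof (intro allI impI)
    fix \<epsilon> :: real
    assume "\<epsilon> > 0"
    \<comment> \<open>The final error is at most \<open>\<eta> * (b - a) + \<eta> = \<epsilon> / 2\<close>.\<close>
    define \<eta> where "\<eta> = \<epsilon> / 2 / (b - a + 1)"
    have pos: "b - a + 1 > 0" using \<open>a \<le> b\<close> by simp
    have "\<eta> > 0" using \<open>\<epsilon> > 0\<close> \<open>a \<le> b\<close> by (simp add: \<eta>_def)
    have "\<eta> * (b - a) + \<eta> = \<eta> * (b - a + 1)" by (simp add: distrib_left)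
    also have "\<dots> = \<epsilon> / 2" by (rule iffD1[OF nonzero_eq_divide_eq \<eta>_def]) (use pos in linarith)
    finally have \<eta>: "\<eta> * (b - a) + \<eta> = \<epsilon> / 2" .
    obtain \<delta> where \<delta>: "\<delta> > 0"
      "\<And>p. \<lbrakk>p tagged_partial_division_of {a..b}; (\<Sum>(x,K)\<in>p. measure lborel K) < \<delta>\<rbrakk>
           \<Longrightarrow> (\<Sum>(x,K)\<in>p. \<bar>F (Sup K) - F (Inf K)\<bar>) < \<eta>"
      using abs_cont_tagged_partial_division[OF ac \<open>\<eta> > 0\<close>] by blast
    obtain U where U: "open U" "N \<subseteq> U" "U \<in> lmeasurable" "measure lebesgue U < \<delta>"
      using negligible_outer_open[OF N \<delta>(1)] by blast
    have "\<exists>d>0. t \<in> {a..b} - N \<longrightarrow>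
        (\<forall>y\<in>{a..b}. \<bar>y - t\<bar> < d \<longrightarrow> \<bar>F y - F t - g t * (y - t)\<bar> \<le> \<eta> * \<bar>y - t\<bar>)" for t
    proof (cases "t \<in> {a..b} - N")
      case True
      then show ?thesis
        using der[OF True] \<open>\<eta> > 0\<close>
        unfolding has_field_derivative_def has_derivative_within_alt real_norm_def by meson
    qed (auto intro: exI[of _ 1])
    then obtain d where d: "\<And>t. d t > 0"
      "\<And>t y. \<lbrakk>t \<in> {a..b} - N; y \<in> {a..b}; \<bar>y - t\<bar> < d t\<rbrakk>
         \<Longrightarrow> \<bar>F y - F t - g t * (y - t)\<bar> \<le> \<eta> * \<bar>y - t\<bar>"
      by metis
    define \<gamma> where "\<gamma> = (\<lambda>t. if t \<in> N then U else ball t (d t))"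
    have "gauge \<gamma>" using U d(1) by (auto simp: gauge_def \<gamma>_def)
    moreover have "norm ((\<Sum>(x,K)\<in>p. measure lborel K *\<^sub>R g0 x) - (F b - F a)) < \<epsilon>"
      if p: "p tagged_division_of {a..b}" and fine: "\<gamma> fine p" for p
    proof -
      note pD = tagged_division_ofD[OF p]
      define q where "q = {z \<in> p. fst z \<in> N}"
      have "finite p" "q \<subseteq> p" using pD(1) by (auto simp: q_def)
      have q: "q tagged_partial_division_of {a..b}"
        using p \<open>q \<subseteq> p\<close> tagged_partial_division_subset[of p "{a..b}" q]
        by (simp add: tagged_division_of_def)
      define err where "err = (\<lambda>(x,K). measure lborel K * g0 x - (F (Sup K) - F (Inf K)))"
      have total: "(\<Sum>(x,K)\<in>p. measure lborel K *\<^sub>R g0 x) - (F b - F a) = sum err p"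
        using additive_tagged_division_1[OF \<open>a \<le> b\<close> p, of F]
        by (simp add: err_def case_prod_beta sum_subtractf)
      have "(\<Sum>z\<in>p - q. \<bar>err z\<bar>) \<le> (\<Sum>z\<in>p - q. \<eta> * measure lborel (snd z))"
      proof (rule sum_mono, clarify)
        fix x K assume "(x, K) \<in> p" "(x, K) \<notin> q"
        then have xK: "(x, K) \<in> p" and "x \<notin> N" by (auto simp: q_def)
        obtain u v where K: "K = {u..v}" using pD(4)[OF xK] by auto
        have "K \<subseteq> ball x (d x)" using fineD[OF fine xK] \<open>x \<notin> N\<close> by (simp add: \<gamma>_def)
        then have "\<bar>F y - F x - g x * (y - x)\<bar> \<le> \<eta> * \<bar>y - x\<bar>" if "y \<in> K" for y
          using that pD(2,3)[OF xK] \<open>x \<notin> N\<close>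
          by (intro d(2)) (auto simp: dist_real_def abs_minus_commute subset_iff)
        from straddle_increment[OF K pD(2)[OF xK] this]
        show "\<bar>err (x, K)\<bar> \<le> \<eta> * measure lborel (snd (x, K))"
          using \<open>x \<notin> N\<close> by (simp add: err_def g0_def)
      qed
      also have "\<dots> \<le> (\<Sum>z\<in>p. \<eta> * measure lborel (snd z))"
        using \<open>\<eta> > 0\<close> \<open>finite p\<close> by (intro sum_mono2) auto
      also have "\<dots> = \<eta> * (b - a)"
        using additive_content_tagged_division[of p a b] p \<open>a \<le> b\<close>
        by (simp add: sum_distrib_left[symmetric] case_prod_beta)
      finally have off_N: "(\<Sum>z\<in>p - q. \<bar>err z\<bar>) \<le> \<eta> * (b - a)" .
      have "(\<Sum>(x,K)\<in>q. measure lborel K) = (\<Sum>K\<in>snd ` q. measure lborel K)"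
        by (rule sum.over_tagged_division_lemma[OF tagged_partial_division_of_Union_self[OF q]])
           (simp add: content_eq_0_interior)
      also have "\<dots> = (\<Sum>K\<in>snd ` q. measure lebesgue K)"
      proof (rule sum.cong[OF refl])
        fix K assume "K \<in> snd ` q"
        then obtain u v where "K = cbox u v" using tagged_partial_division_ofD(4)[OF q] by force
        then show "measure lborel K = measure lebesgue K" by simp
      qed
      also have "\<dots> = measure lebesgue (\<Union>(snd ` q))"
        by (rule content_division[OF partial_division_of_tagged_division[OF q]])
      also have "\<dots> \<le> measure lebesgue U"
      proof (rule measure_mono_fmeasurable)
        show "\<Union>(snd ` q) \<subseteq> U"
          using fine by (fastforce simp: q_def \<gamma>_def dest: fineD split: if_splits)
        show "\<Union>(snd ` q) \<in> sets lebesgue"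
          using lmeasurable_division[OF partial_division_of_tagged_division[OF q]] by blast
      qed (rule U)
      finally have "(\<Sum>(x,K)\<in>q. \<bar>F (Sup K) - F (Inf K)\<bar>) < \<eta>"
        using U(4) by (intro \<delta>(2)[OF q]) simp
      moreover have "(\<Sum>z\<in>q. \<bar>err z\<bar>) = (\<Sum>(x,K)\<in>q. \<bar>F (Sup K) - F (Inf K)\<bar>)"
        by (rule sum.cong) (auto simp: err_def g0_def q_def)
      ultimately have on_N: "(\<Sum>z\<in>q. \<bar>err z\<bar>) < \<eta>" by simp
      have "\<bar>sum err p\<bar> \<le> (\<Sum>z\<in>p. \<bar>err z\<bar>)" by (rule sum_abs)
      also have "\<dots> = (\<Sum>z\<in>p - q. \<bar>err z\<bar>) + (\<Sum>z\<in>q. \<bar>err z\<bar>)"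
        by (rule sum.subset_diff[OF \<open>q \<subseteq> p\<close> \<open>finite p\<close>])
      also have "\<dots> < \<epsilon>" using off_N on_N \<eta> \<open>\<epsilon> > 0\<close> by simp
      finally show ?thesis unfolding total real_norm_def .
    qed
    ultimately show "\<exists>\<gamma>. gauge \<gamma> \<and> (\<forall>p. p tagged_division_of {a..b} \<and> \<gamma> fine p \<longrightarrow>
        norm ((\<Sum>(x,K)\<in>p. measure lborel K *\<^sub>R g0 x) - (F b - F a)) < \<epsilon>)"
      by (intro exI[of _ \<gamma>] conjI allI impI) (simp_all only:)
  qed
  then show ?thesis
    by (rule has_integral_spike[OF N, rotated]) (auto simp: g0_def)
qed

section \<open>Variation of constants\<close>

text \<open>
  Apply the fundamental theorem to \<open>exp (- k * (T - t)) * y t\<close>: in its derivative the terms in \<open>y\<close>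
  cancel, leaving \<open>exp (- k * (T - t)) * h t\<close>.
\<close>

lemma linear_ode_solution:
  fixes y h :: "real \<Rightarrow> real" and k T :: real
  assumes "T \<ge> 0" and h: "set_integrable lebesgue {0..T} h"
    and ac: "abs_cont_on_interval 0 T y"
    and ode: "AE t\<in>{0..T} in lebesgue. (y has_real_derivative (- k * y t + h t)) (at t within {0..T})"
  shows "y T = exp (- k * T) * y 0 + (LINT t:{0..T}|lebesgue. exp (- k * (T - t)) * h t)"
proof -
  let ?w = "\<lambda>t. exp (- k * (T - t))"
  obtain N where N: "N \<in> null_sets lebesgue"
    "{t \<in> space lebesgue. \<not> (t \<in> {0..T} \<longrightarrow> (y has_real_derivative (- k * y t + h t)) (at t within {0..T}))} \<subseteq> N"
    using ode by (rule AE_E) (blast intro: null_setsI)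
  have "abs_cont_on_interval 0 T ?w"
    using abs_cont_exp_affine[of 0 T k "- k * T"] by (simp add: algebra_simps)
  then have "abs_cont_on_interval 0 T (\<lambda>t. ?w t * y t)" using ac by (rule abs_cont_mult)
  moreover have "((\<lambda>t. ?w t * y t) has_real_derivative ?w t * h t) (at t within {0..T})"
    if "t \<in> {0..T} - N" for t
  proof -
    have [derivative_intros]: "(y has_real_derivative (- k * y t + h t)) (at t within {0..T})"
      using N(2) that by auto
    show ?thesis by (auto intro!: derivative_eq_intros simp: algebra_simps)
  qed
  ultimately have "((\<lambda>t. ?w t * h t) has_integral (?w T * y T - ?w 0 * y 0)) {0..T}"
    using \<open>T \<ge> 0\<close> N(1)
    by (intro abs_cont_has_integral) (auto simp: negligible_iff_null_sets)
  then have "integral {0..T} (\<lambda>t. ?w t * h t) = y T - exp (- k * T) * y 0"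
    by (simp add: integral_unique)
  moreover have "set_integrable lebesgue {0..T} (\<lambda>t. ?w t * h t)"
  proof (rule absolutely_integrable_bounded_measurable_product_real[OF _ _ _ h])
    have cont: "continuous_on {0..T} ?w" by (intro continuous_intros)
    show "?w \<in> borel_measurable (lebesgue_on {0..T})"
      using cont by (rule continuous_imp_measurable_on_sets_lebesgue) simp
    show "bounded (?w ` {0..T})"
      using cont compact_continuous_image compact_imp_bounded by blast
  qed simp
  ultimately show ?thesis by (simp add: set_lebesgue_integral_eq_integral(2))
qed

section \<open>The endpoint of the system\<close>

text \<open>
  In the combination that isolates \<open>M13\<close>, the coefficients \<open>- 8/13\<close> and \<open>7/52\<close> remove \<open>x\<close> and \<open>A\<close> from the
  equation for \<open>e\<close>: the condition for \<open>x\<close> reads \<open>8 = 13 * (8/13)\<close>, that for \<open>A\<close> reads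
  \<open>- 1 - 8/13 - 7/52 = - 13 * (7/52)\<close>.
\<close>

theorem theorem5p1:
  fixes T M0 M1 M13 :: real and f A x e :: "real \<Rightarrow> real"
  assumes "T > 0"
    and "set_integrable lebesgue {0..T} f"
    and "system_solution T f A x e"
    and "M0 = (LINT t:{0..T}|lebesgue. f t)"
    and "M1 = (LINT t:{0..T}|lebesgue. exp (- (T - t)) * f t)"
    and "M13 = (LINT t:{0..T}|lebesgue. exp (- 13 * (T - t)) * f t)"
  shows "A T = M1 \<and> x T = M0 - M1 \<and> e T = (32 * M0 - 39 * M1 + 7 * M13) / 52 \<and>
    ((A T, x T, e T) = (0, 0, 0) \<longleftrightarrow> M0 = 0 \<and> M1 = 0 \<and> M13 = 0)"
proof -
  have ac: "abs_cont_on_interval 0 T A" "abs_cont_on_interval 0 T x" "abs_cont_on_interval 0 T e"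
    and init: "A 0 = 0" "x 0 = 0" "e 0 = 0"
    and ode: "AE t\<in>{0..T} in lebesgue.
        (A has_real_derivative (- A t + f t)) (at t within {0..T}) \<and>
        (x has_real_derivative A t) (at t within {0..T}) \<and>
        (e has_real_derivative (8 * x t - 13 * e t - A t)) (at t within {0..T})"
    using assms(3) unfolding system_solution_def by auto
  have "T \<ge> 0" using assms(1) by simp
  note solve = linear_ode_solution[OF \<open>T \<ge> 0\<close>]

  have "AE t\<in>{0..T} in lebesgue. (A has_real_derivative (- 1 * A t + f t)) (at t within {0..T})"
    using ode by eventually_elim auto
  from solve[OF assms(2) ac(1) this] have A: "A T = M1"
    by (simp add: init assms(5))

  \<comment> \<open>The factors \<open>1\<close> and \<open>- 0\<close> match the shapes in \<open>abs_cont_lincomb\<close> and \<open>linear_ode_solution\<close>.\<close>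
  let ?s = "\<lambda>t. 1 * A t + 1 * x t"
  have "AE t\<in>{0..T} in lebesgue. (?s has_real_derivative (- 0 * ?s t + f t)) (at t within {0..T})"
    using ode by eventually_elim (auto intro!: derivative_eq_intros)
  from solve[OF assms(2) abs_cont_lincomb[OF ac(1,2)] this] have s: "A T + x T = M0"
    by (simp add: init assms(4))

  let ?z = "\<lambda>t. 1 * e t + 1 * ((- 8 / 13) * x t + 7 / 52 * A t)"
  have ac_z: "abs_cont_on_interval 0 T ?z"
    by (intro abs_cont_lincomb ac)
  have int_z: "set_integrable lebesgue {0..T} (\<lambda>t. 7 / 52 * f t)"
    using assms(2) by simp
  have "AE t\<in>{0..T} in lebesgue.
      (?z has_real_derivative (- 13 * ?z t + 7 / 52 * f t)) (at t within {0..T})"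
    using ode by eventually_elim (auto intro!: derivative_eq_intros simp: field_simps)
  from solve[OF int_z ac_z this] have "?z T = (LINT t:{0..T}|lebesgue. 7 / 52 * (exp (- 13 * (T - t)) * f t))"
    by (simp add: init mult.left_commute)
  also have "\<dots> = 7 / 52 * M13"
    unfolding assms(6) by (rule set_integral_mult_right)
  finally have z: "e T - 8 / 13 * x T + 7 / 52 * A T = 7 / 52 * M13" by simp

  have x: "x T = M0 - M1" using A s by simp
  have e: "e T = (32 * M0 - 39 * M1 + 7 * M13) / 52" using z unfolding A x by (simp add: field_simps)
  show ?thesis unfolding A x e by auto
qed

end
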